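(* Let $T>0$, let $\sigma(t,x)\neq0$ for all $(t,x)$, and consider the forward-backward stochastic differential equation (FBSDE) $$dX_t=b(t,X_t)\,dt+\sigma(t,X_t)\,dW_t,\qquad dY_t=-g(t,X_t,Y_t,Z_t)\,dt+Z_t\,dW_t,\qquad Y_T=H(X_T),$$ together with the associated semi-linear PDE $$\partial_t u+b(t,x)\,\partial_x u+\tfrac12\sigma^2(t,x)\,\partial_{xx}^2u+g\big(t,x,u,\sigma(t,x)\partial_xu\big)=0\ \text{ on }[0,T)\times\mathbb{R},\qquad u(T,x)=H(x).$$ Let $\mathcal{L}_{FBSDE}$ be the space of symmetries of the FBSDE, $\mathcal{L}_{PDE}$ the symmetry algebra of the PDE, and $\widehat{\mathcal{L}}_{PDE}\subseteq\mathcal{L}_{PDE}$ the set of symmetries of the PDE with $\delta_x=0$ (all as defined in the context). If $g$ is independent of $z$, then $$\mathcal{L}_{FBSDE}=\widehat{\mathcal{L}}_{PDE}\subseteq\mathcal{L}_{PDE}.$$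
   Context: The functions $b,\sigma:[0,T]\times\mathbb{R}\to\mathbb{R}$, $g=g(t,x,y,z):[0,T]\times\mathbb{R}^3\to\mathbb{R}$, $H:\mathbb{R}\to\mathbb{R}$ and all coefficients of vector fields are deterministic and smooth; subscripts denote partial derivatives. $W$ is a standard one-dimensional Brownian motion. The PDE variable $u$ is identified with the variable $y$, and $\sigma u_x$ with $z$, via $Y_t=u(t,X_t)$, $Z_t=\sigma(t,X_t)\partial_xu(t,X_t)$. Symmetries of the FBSDE. One considers projectable vector fields $v=\tau(t)\partial_t+\xi(t,x,y)\partial_x+\eta(t,x,y)\partial_y$ and, to first order in $\varepsilon$, the transformation $\tilde t=t+\varepsilon\tau$, $\tilde x=x+\varepsilon\xi$, $\tilde y=y+\varepsilon\eta$, $d\tilde W=(1+\frac{\varepsilon}{2}\tau'(t))\,dW$, which induces $\tilde z=z+\varepsilon(\sigma\eta_x+\eta_yz-\frac12\tau_tz)$. The field $v$ is a symmetry of the FBSDE if for solutions $(X,Y,Z)$ the transformed process $(\tilde X_{\tilde t},\tilde Y_{\tilde t},\tilde Z_{\tilde t})$ again satisfies the FBSDE (with the same $b,\sigma,g,H$, in time $\tilde t$, driven by $\tilde W$, with terminal relation $\tilde Y_{\tilde T}=H(\tilde X_{\tilde T})$). The criterion for this used in the paper (a recalled result of Zhang and Jia, in simplified form) is: $v$ is a symmetry of the FBSDE if and only if $\xi=\xi(t,x)$ and, for all $(t,x,y,z)$, $$(g\tau)_{t}+g_{x}\xi+g_{y}\eta+g_{z}\big(\sigma\eta_{x}+(\eta_{y}-\tfrac{1}{2}\tau_{t})z\big)+\eta_{t}+b\eta_{x}-g\eta_{y}+\tfrac{1}{2}\big(\sigma^{2}\eta_{xx}+\eta_{yy}z^{2}+\eta_{xy}\sigma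 z\big)=0,$$ $$\xi_{t}+\tfrac{1}{2}\sigma^{2}\xi_{xx}+b\xi_{x}-b_{x}\xi-(b\tau)_{t}=0,$$ $$-\sigma\xi_{x}+\sigma_{x}\xi+\tfrac{1}{2}\sigma\tau_{t}+\sigma_{t}\tau=0,$$ $$\eta(t, x, H(x)) \equiv \partial_x H(x)\, \xi(t, x).$$ $\mathcal{L}_{FBSDE}$ is the set of all such symmetries. Symmetries of the PDE. A vector field $v=\theta(t,x,u)\partial_t+\gamma(t,x,u)\partial_x+\phi(t,x,u)\partial_u$ is a symmetry generator of the PDE if its (local) one-parameter group $\exp(\varepsilon v)$ maps (graphs of) solutions of the differential equation to (graphs of) solutions, equivalently in Olver's sense: with $\Delta=u_t+b u_x+\frac12\sigma^2u_{xx}+g(t,x,u,\sigma u_x)$, the second prolongation satisfies $\mathrm{pr}^{(2)}v(\Delta)=0$ whenever $\Delta=0$; and in addition the terminal condition is preserved, meaning that $u=H(x)$ is invariant under the group, i.e. $\phi(t,x,H(x))\equiv\partial_xH(x)\,\gamma(t,x,H(x))$. $\mathcal{L}_{PDE}$ is the set (Lie algebra) of all symmetry generators of the PDE. When $\sigma\neq0$ its elements have the form $\theta(t)\partial_t+\gamma(t,x)\partial_x+\big(\delta(t,x)u+\beta(t,x)\big)\partial_u$ for some functions $\delta,\beta$, with $\beta(t,x)=\partial_xH(x)\gamma(t,x)-\delta(t,x)H(x)$, and $$\widehat{\mathcal{L}}_{PDE}:=\{v\in\mathcal{L}_{PDE}:\ \delta_x=0\}.$$ *)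

theory Defs
  imports "HOL-Analysis.Analysis"
begin

text \<open>\<open>C\<^sup>\<infinity>\<close> on a set: differentiable within \<open>S\<close>, all directional derivatives being again
  \<open>C\<^sup>\<infinity>\<close>.  It is used only for \<open>S = [0,T] \<times> \<real>\<^sup>n\<close> and \<open>S = \<real>\<close>, where derivatives within \<open>S\<close> are
  unique; at \<open>t = 0\<close> and \<open>t = T\<close> the derivatives are one-sided in time.\<close>

coinductive smooth_on :: "'a::euclidean_space set \<Rightarrow> ('a \<Rightarrow> real) \<Rightarrow> bool" for S where
  "\<lbrakk>\<And>p. p \<in> S \<Longrightarrow> (f has_derivative f' p) (at p within S);
    \<And>v. smooth_on S (\<lambda>p. f' p v)\<rbrakk> \<Longrightarrow> smooth_on S f"

text \<open>Time derivative of a function on \<open>[0,T]\<close>, one-sided at the end points.\<close>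

definition dt :: "real \<Rightarrow> (real \<Rightarrow> real) \<Rightarrow> real \<Rightarrow> real" where
  "dt T f t = vector_derivative f (at t within {0..T})"

definition smooth_coefficients ::
  "real \<Rightarrow> (real \<Rightarrow> real \<Rightarrow> real) \<Rightarrow> (real \<Rightarrow> real \<Rightarrow> real) \<Rightarrow>
   (real \<Rightarrow> real \<Rightarrow> real \<Rightarrow> real \<Rightarrow> real) \<Rightarrow> (real \<Rightarrow> real) \<Rightarrow> bool" where
  "smooth_coefficients T b \<sigma> g H \<longleftrightarrow>
     smooth_on ({0..T} \<times> UNIV) (\<lambda>(t, x). b t x) \<and>
     smooth_on ({0..T} \<times> UNIV) (\<lambda>(t, x). \<sigma> t x) \<and>
     smooth_on ({0..T} \<times> UNIV) (\<lambda>(t, x, y, z). g t x y z) \<and>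
     smooth_on UNIV H"

text \<open>A triple \<open>(\<theta>, \<gamma>, \<phi>)\<close> stands for the vector field \<open>\<theta> \<partial>\<^sub>t + \<gamma> \<partial>\<^sub>x + \<phi> \<partial>\<^sub>u\<close>, with coefficients
  depending on \<open>(t, x, u)\<close>; the PDE variable \<open>u\<close> and the FBSDE variable \<open>y\<close> are identified.
  Only the values for \<open>t \<in> [0,T]\<close> are constrained below.\<close>

type_synonym vec_field =
  "(real \<Rightarrow> real \<Rightarrow> real \<Rightarrow> real) \<times> (real \<Rightarrow> real \<Rightarrow> real \<Rightarrow> real) \<times> (real \<Rightarrow> real \<Rightarrow> real \<Rightarrow> real)"

definition smooth_vec_field :: "real \<Rightarrow> vec_field \<Rightarrow> bool" where
  "smooth_vec_field T = (\<lambda>(\<theta>, \<gamma>, \<phi>).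
     smooth_on ({0..T} \<times> UNIV) (\<lambda>(t, x, u). \<theta> t x u) \<and>
     smooth_on ({0..T} \<times> UNIV) (\<lambda>(t, x, u). \<gamma> t x u) \<and>
     smooth_on ({0..T} \<times> UNIV) (\<lambda>(t, x, u). \<phi> t x u))"

text \<open>Symmetries \<open>\<tau>(t) \<partial>\<^sub>t + \<xi> \<partial>\<^sub>x + \<eta> \<partial>\<^sub>y\<close> of the FBSDE
  \<open>dX = b dt + \<sigma> dW\<close>, \<open>dY = - g dt + Z dW\<close>, \<open>Y\<^sub>T = H(X\<^sub>T)\<close>, taken in the sense of the determining
  equations of Zhang and Jia (simplified form): invariance of the FBSDE to first order in \<open>\<epsilon>\<close> under
  \<open>t + \<epsilon> \<tau>\<close>, \<open>x + \<epsilon> \<xi>\<close>, \<open>y + \<epsilon> \<eta>\<close>, \<open>z + \<epsilon> (\<sigma> \<eta>\<^sub>x + \<eta>\<^sub>y z - \<tau>\<^sub>t z / 2)\<close>,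
  \<open>(1 + \<epsilon> \<tau>\<^sub>t / 2) dW\<close>.
  The four groups of equations are the drift of \<open>Y\<close>, the drift of \<open>X\<close>, the diffusion of \<open>X\<close> and
  the terminal relation.\<close>

definition L_FBSDE ::
  "real \<Rightarrow> (real \<Rightarrow> real \<Rightarrow> real) \<Rightarrow> (real \<Rightarrow> real \<Rightarrow> real) \<Rightarrow>
   (real \<Rightarrow> real \<Rightarrow> real \<Rightarrow> real \<Rightarrow> real) \<Rightarrow> (real \<Rightarrow> real) \<Rightarrow> vec_field set" where
  "L_FBSDE T b \<sigma> g H = {(\<theta>, \<gamma>, \<eta>). smooth_vec_field T (\<theta>, \<gamma>, \<eta>) \<and>
     (\<exists>\<tau> \<xi>.
       (\<forall>t\<in>{0..T}. \<forall>x y. \<theta> t x y = \<tau> t \<and> \<gamma> t x y = \<xi> t x) \<and>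
       (\<forall>t\<in>{0..T}. \<forall>x y z.
          dt T (\<lambda>s. g s x y z * \<tau> s) t
          + deriv (\<lambda>v. g t v y z) x * \<xi> t x
          + deriv (\<lambda>w. g t x w z) y * \<eta> t x y
          + deriv (\<lambda>k. g t x y k) z *
              (\<sigma> t x * deriv (\<lambda>v. \<eta> t v y) x + (deriv (\<lambda>w. \<eta> t x w) y - 1/2 * dt T \<tau> t) * z)
          + dt T (\<lambda>s. \<eta> s x y) t
          + b t x * deriv (\<lambda>v. \<eta> t v y) x
          - g t x y z * deriv (\<lambda>w. \<eta> t x w) y
          + 1/2 * ((\<sigma> t x)\<^sup>2 * deriv (\<lambda>v. deriv (\<lambda>v'. \<eta> t v' y) v) x
                   + deriv (\<lambda>w. deriv (\<lambda>w'. \<eta> t x w') w) y * z\<^sup>2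
                   + deriv (\<lambda>w. deriv (\<lambda>v. \<eta> t v w) x) y * \<sigma> t x * z) = 0) \<and>
       (\<forall>t\<in>{0..T}. \<forall>x.
          dt T (\<lambda>s. \<xi> s x) t + 1/2 * (\<sigma> t x)\<^sup>2 * deriv (\<lambda>v. deriv (\<lambda>v'. \<xi> t v') v) x
          + b t x * deriv (\<lambda>v. \<xi> t v) x - deriv (\<lambda>v. b t v) x * \<xi> t x
          - dt T (\<lambda>s. b s x * \<tau> s) t = 0) \<and>
       (\<forall>t\<in>{0..T}. \<forall>x.
          - \<sigma> t x * deriv (\<lambda>v. \<xi> t v) x + deriv (\<lambda>v. \<sigma> t v) x * \<xi> t x
          + 1/2 * \<sigma> t x * dt T \<tau> t + dt T (\<lambda>s. \<sigma> s x) t * \<tau> t = 0) \<and>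
       (\<forall>t\<in>{0..T}. \<forall>x. \<eta> t x (H x) = deriv H x * \<xi> t x))}"

text \<open>Jet coordinates: \<open>p = u\<^sub>t\<close>, \<open>q = u\<^sub>x\<close>, \<open>r = u\<^sub>t\<^sub>t\<close>, \<open>s = u\<^sub>t\<^sub>x\<close>, \<open>w = u\<^sub>x\<^sub>x\<close>.
  \<open>Dt0\<close>, \<open>Dx0\<close> are the total derivatives of functions of \<open>(t, x, u)\<close>, and \<open>Dt1\<close>, \<open>Dx1\<close> those of
  functions of \<open>(t, x, u, p, q)\<close>.\<close>

definition Dt0 :: "real \<Rightarrow> (real \<Rightarrow> real \<Rightarrow> real \<Rightarrow> real) \<Rightarrow> real \<Rightarrow> real \<Rightarrow> real \<Rightarrow> real \<Rightarrow> real" where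
  "Dt0 T f t x u p = dt T (\<lambda>t'. f t' x u) t + p * deriv (\<lambda>u'. f t x u') u"

definition Dx0 :: "(real \<Rightarrow> real \<Rightarrow> real \<Rightarrow> real) \<Rightarrow> real \<Rightarrow> real \<Rightarrow> real \<Rightarrow> real \<Rightarrow> real" where
  "Dx0 f t x u q = deriv (\<lambda>x'. f t x' u) x + q * deriv (\<lambda>u'. f t x u') u"

definition Dt1 :: "real \<Rightarrow> (real \<Rightarrow> real \<Rightarrow> real \<Rightarrow> real \<Rightarrow> real \<Rightarrow> real) \<Rightarrow>
    real \<Rightarrow> real \<Rightarrow> real \<Rightarrow> real \<Rightarrow> real \<Rightarrow> real \<Rightarrow> real \<Rightarrow> real" where
  "Dt1 T F t x u p q r s = dt T (\<lambda>t'. F t' x u p q) t + p * deriv (\<lambda>u'. F t x u' p q) u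
     + r * deriv (\<lambda>p'. F t x u p' q) p + s * deriv (\<lambda>q'. F t x u p q') q"

definition Dx1 :: "(real \<Rightarrow> real \<Rightarrow> real \<Rightarrow> real \<Rightarrow> real \<Rightarrow> real) \<Rightarrow>
    real \<Rightarrow> real \<Rightarrow> real \<Rightarrow> real \<Rightarrow> real \<Rightarrow> real \<Rightarrow> real \<Rightarrow> real" where
  "Dx1 F t x u p q s w = deriv (\<lambda>x'. F t x' u p q) x + q * deriv (\<lambda>u'. F t x u' p q) u
     + s * deriv (\<lambda>p'. F t x u p' q) p + w * deriv (\<lambda>q'. F t x u p q') q"

text \<open>Coefficients of the prolonged vector field, by Olver's recursion
  \<open>\<phi>\<^sup>J\<^sup>,\<^sup>k = D\<^sub>k \<phi>\<^sup>J - (D\<^sub>k \<theta>) u\<^sub>J\<^sub>,\<^sub>t - (D\<^sub>k \<gamma>) u\<^sub>J\<^sub>,\<^sub>x\<close>.\<close>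

definition prol_t :: "real \<Rightarrow> vec_field \<Rightarrow> real \<Rightarrow> real \<Rightarrow> real \<Rightarrow> real \<Rightarrow> real \<Rightarrow> real" where
  "prol_t T = (\<lambda>(\<theta>, \<gamma>, \<phi>) t x u p q.
     Dt0 T \<phi> t x u p - Dt0 T \<theta> t x u p * p - Dt0 T \<gamma> t x u p * q)"

definition prol_x :: "vec_field \<Rightarrow> real \<Rightarrow> real \<Rightarrow> real \<Rightarrow> real \<Rightarrow> real \<Rightarrow> real" where
  "prol_x = (\<lambda>(\<theta>, \<gamma>, \<phi>) t x u p q.
     Dx0 \<phi> t x u q - Dx0 \<theta> t x u q * p - Dx0 \<gamma> t x u q * q)"

definition prol_tt :: "real \<Rightarrow> vec_field \<Rightarrow>
    real \<Rightarrow> real \<Rightarrow> real \<Rightarrow> real \<Rightarrow> real \<Rightarrow> real \<Rightarrow> real \<Rightarrow> real" where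
  "prol_tt T = (\<lambda>(\<theta>, \<gamma>, \<phi>) t x u p q r s.
     Dt1 T (prol_t T (\<theta>, \<gamma>, \<phi>)) t x u p q r s - Dt0 T \<theta> t x u p * r - Dt0 T \<gamma> t x u p * s)"

definition prol_tx :: "real \<Rightarrow> vec_field \<Rightarrow>
    real \<Rightarrow> real \<Rightarrow> real \<Rightarrow> real \<Rightarrow> real \<Rightarrow> real \<Rightarrow> real \<Rightarrow> real \<Rightarrow> real" where
  "prol_tx T = (\<lambda>(\<theta>, \<gamma>, \<phi>) t x u p q r s w.
     Dx1 (prol_t T (\<theta>, \<gamma>, \<phi>)) t x u p q s w - Dx0 \<theta> t x u q * r - Dx0 \<gamma> t x u q * s)"

definition prol_xx :: "vec_field \<Rightarrow>
    real \<Rightarrow> real \<Rightarrow> real \<Rightarrow> real \<Rightarrow> real \<Rightarrow> real \<Rightarrow> real \<Rightarrow> real" where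
  "prol_xx = (\<lambda>(\<theta>, \<gamma>, \<phi>) t x u p q s w.
     Dx1 (prol_x (\<theta>, \<gamma>, \<phi>)) t x u p q s w - Dx0 \<theta> t x u q * s - Dx0 \<gamma> t x u q * w)"

type_synonym jet_fun =
  "real \<Rightarrow> real \<Rightarrow> real \<Rightarrow> real \<Rightarrow> real \<Rightarrow> real \<Rightarrow> real \<Rightarrow> real \<Rightarrow> real"

definition pr2 :: "real \<Rightarrow> vec_field \<Rightarrow> jet_fun \<Rightarrow> jet_fun" where
  "pr2 T = (\<lambda>(\<theta>, \<gamma>, \<phi>) F t x u p q r s w.
     \<theta> t x u * dt T (\<lambda>t'. F t' x u p q r s w) t
     + \<gamma> t x u * deriv (\<lambda>x'. F t x' u p q r s w) x
     + \<phi> t x u * deriv (\<lambda>u'. F t x u' p q r s w) u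
     + prol_t T (\<theta>, \<gamma>, \<phi>) t x u p q * deriv (\<lambda>p'. F t x u p' q r s w) p
     + prol_x (\<theta>, \<gamma>, \<phi>) t x u p q * deriv (\<lambda>q'. F t x u p q' r s w) q
     + prol_tt T (\<theta>, \<gamma>, \<phi>) t x u p q r s * deriv (\<lambda>r'. F t x u p q r' s w) r
     + prol_tx T (\<theta>, \<gamma>, \<phi>) t x u p q r s w * deriv (\<lambda>s'. F t x u p q r s' w) s
     + prol_xx (\<theta>, \<gamma>, \<phi>) t x u p q s w * deriv (\<lambda>w'. F t x u p q r s w') w)"

definition PDE_lhs :: "(real \<Rightarrow> real \<Rightarrow> real) \<Rightarrow> (real \<Rightarrow> real \<Rightarrow> real) \<Rightarrow>
    (real \<Rightarrow> real \<Rightarrow> real \<Rightarrow> real \<Rightarrow> real) \<Rightarrow> jet_fun" where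
  "PDE_lhs b \<sigma> g = (\<lambda>t x u p q r s w.
     p + b t x * q + 1/2 * (\<sigma> t x)\<^sup>2 * w + g t x u (\<sigma> t x * q))"

text \<open>Symmetry generators of the terminal value problem: infinitesimal invariance of the equation
  on \<open>[0,T) \<times> \<real>\<close> in Olver's sense, together with invariance of the terminal relation \<open>u = H(x)\<close>.
  The coefficients are not assumed to be projectable.\<close>

definition L_PDE ::
  "real \<Rightarrow> (real \<Rightarrow> real \<Rightarrow> real) \<Rightarrow> (real \<Rightarrow> real \<Rightarrow> real) \<Rightarrow>
   (real \<Rightarrow> real \<Rightarrow> real \<Rightarrow> real \<Rightarrow> real) \<Rightarrow> (real \<Rightarrow> real) \<Rightarrow> vec_field set" where
  "L_PDE T b \<sigma> g H = {(\<theta>, \<gamma>, \<phi>). smooth_vec_field T (\<theta>, \<gamma>, \<phi>) \<and>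
     (\<forall>t\<in>{0..<T}. \<forall>x u p q r s w. PDE_lhs b \<sigma> g t x u p q r s w = 0 \<longrightarrow>
        pr2 T (\<theta>, \<gamma>, \<phi>) (PDE_lhs b \<sigma> g) t x u p q r s w = 0) \<and>
     (\<forall>t\<in>{0..T}. \<forall>x. \<phi> t x (H x) = deriv H x * \<gamma> t x (H x))}"

text \<open>The symmetries \<open>\<theta>(t) \<partial>\<^sub>t + \<gamma>(t,x) \<partial>\<^sub>x + (\<delta>(t,x) u + \<beta>(t,x)) \<partial>\<^sub>u\<close> of the PDE with
  \<open>\<delta>\<^sub>x = 0\<close>.  That \<open>\<theta>\<close> depends on \<open>t\<close> only and \<open>\<gamma>\<close> on \<open>(t,x)\<close> only is a consequence of membership
  in \<open>L_PDE\<close> when \<open>\<sigma> \<noteq> 0\<close>, and \<open>\<beta> = H\<^sub>x \<gamma> - \<delta> H\<close> is the terminal relation, so neither is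
  required here.\<close>

definition L_PDE_hat ::
  "real \<Rightarrow> (real \<Rightarrow> real \<Rightarrow> real) \<Rightarrow> (real \<Rightarrow> real \<Rightarrow> real) \<Rightarrow>
   (real \<Rightarrow> real \<Rightarrow> real \<Rightarrow> real \<Rightarrow> real) \<Rightarrow> (real \<Rightarrow> real) \<Rightarrow> vec_field set" where
  "L_PDE_hat T b \<sigma> g H = {(\<theta>, \<gamma>, \<phi>). (\<theta>, \<gamma>, \<phi>) \<in> L_PDE T b \<sigma> g H \<and>
     (\<exists>\<delta> \<beta>. (\<forall>t\<in>{0..T}. \<forall>x u. \<phi> t x u = \<delta> t x * u + \<beta> t x) \<and>
       (\<forall>t\<in>{0..T}. \<forall>x. ((\<lambda>v. \<delta> t v) has_real_derivative 0) (at x)))}"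

end

theory Submission
  imports Defs
begin

text \<open>Let \<open>\<Delta>\<close> be the left-hand side of the PDE.  Since \<open>\<sigma> \<noteq> 0\<close>, invariance modulo \<open>\<Delta> = 0\<close> forces
  \<open>\<theta> = \<tau>(t)\<close> (from the terms in \<open>u\<^sub>t\<^sub>x\<close>) and \<open>\<gamma> = \<xi>(t,x)\<close> (from the terms in \<open>u\<^sub>x u\<^sub>x\<^sub>x\<close>).  As \<open>g\<close> does not
  depend on \<open>z\<close>, the drift equation of \<open>Y\<close> is a polynomial in \<open>z\<close> whose terms of degree one and two
  say \<open>\<eta>\<^sub>x\<^sub>y = \<eta>\<^sub>y\<^sub>y = 0\<close>.  So on either side \<open>\<eta> = \<delta>(t) y + \<beta>(t,x)\<close>, and for such fields
  \<open>pr\<^sup>(\<^sup>2\<^sup>) v(\<Delta>) = (\<delta> - \<tau>\<^sub>t) \<Delta> + E\<^sub>Y - u\<^sub>x E\<^sub>X + \<sigma> u\<^sub>x\<^sub>x E\<^sub>\<sigma>\<close>, where \<open>E\<^sub>Y\<close>, \<open>E\<^sub>X\<close>, \<open>E\<^sub>\<sigma>\<close> are the left-hand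
  sides of the determining equations of the FBSDE.  The PDE criterion is only imposed for \<open>t < T\<close>;
  continuity supplies \<open>t = T\<close>.\<close>

lemma smooth_on_cong:
  assumes "smooth_on S f" and "\<And>p. p \<in> S \<Longrightarrow> f p = h p"
  shows "smooth_on S h"
  using assms(1)
proof cases
  case (1 f')
  show ?thesis
  proof (rule smooth_on.intros[of S _ f'])
    show "(h has_derivative f' p) (at p within S)" if "p \<in> S" for p
      using has_derivative_transform[OF that, of h f] assms(2) 1(1)[OF that] by simp
  qed (rule 1(2))
qed

lemma smooth_on_continuous_on:
  assumes "smooth_on S f" shows "continuous_on S f"
  using assms
proof cases
  case (1 f')
  show ?thesis
    by (rule has_derivative_continuous_on[OF 1(1)])
qed

lemma smooth_on_compose_affine:
  fixes A :: "'a::euclidean_space \<Rightarrow> 'b::euclidean_space"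
  assumes "smooth_on S f" and "bounded_linear L" and "\<And>p. A p = a + L p" and "A ` S' \<subseteq> S"
  shows "smooth_on S' (\<lambda>p. f (A p))"
proof -
  have A: "(A has_derivative L) (at p within S')" for p
  proof -
    have "((\<lambda>p. a + L p) has_derivative (\<lambda>h. 0 + L h)) (at p within S')"
      by (intro has_derivative_add has_derivative_const bounded_linear_imp_has_derivative assms(2))
    moreover have "A = (\<lambda>p. a + L p)"
      using assms(3) by blast
    ultimately show ?thesis
      by simp
  qed
  define X where "X h \<longleftrightarrow> (\<exists>f. smooth_on S f \<and> h = (\<lambda>p. f (A p)))" for h
  have "X (\<lambda>p. f (A p))"
    unfolding X_def using assms(1) by blast
  then show ?thesis
  proof (coinduct rule: smooth_on.coinduct)
    case (smooth_on h)
    then obtain k where k: "smooth_on S k" "h = (\<lambda>p. k (A p))"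
      unfolding X_def by blast
    from k(1) obtain k' where k': "\<And>p. p \<in> S \<Longrightarrow> (k has_derivative k' p) (at p within S)"
      "\<And>v. smooth_on S (\<lambda>p. k' p v)"
      by cases blast
    have "(h has_derivative (\<lambda>v. k' (A p) (L v))) (at p within S')" if "p \<in> S'" for p
      unfolding k(2) by (rule has_derivative_in_compose2[OF k'(1) assms(4) that A])
    moreover have "X (\<lambda>p. k' (A p) (L v))" for v
      unfolding X_def by (rule exI[of _ "\<lambda>p. k' p (L v)"]) (simp add: k'(2))
    ultimately show ?case
      by (intro exI[of _ h] exI[of _ "\<lambda>p v. k' (A p) (L v)"]) simp
  qed
qed

lemma has_derivative_along_curve:
  fixes f :: "'a::real_normed_vector \<Rightarrow> real"
  assumes "\<And>p. p \<in> S \<Longrightarrow> (f has_derivative f' p) (at p within S)"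
    and "c ` I \<subseteq> S" and "i \<in> I" and "(c has_vector_derivative e) (at i within I)"
  shows "((\<lambda>s. f (c s)) has_real_derivative f' (c i) e) (at i within I)"
proof -
  have "((\<lambda>s. f (c s)) has_derivative (\<lambda>h. f' (c i) (h *\<^sub>R e))) (at i within I)"
    using has_derivative_in_compose2[OF assms(1,2,3)] assms(4)
    unfolding has_vector_derivative_def by blast
  moreover have "linear (f' (c i))"
    using assms(1)[of "c i"] assms(2,3) has_derivative_linear by blast
  then have "(\<lambda>h. f' (c i) (h *\<^sub>R e)) = (*) (f' (c i) e)"
    by (intro ext) (simp add: linear_scale mult.commute)
  ultimately show ?thesis
    unfolding has_field_derivative_def by simp
qed

definition smooth3 :: "real \<Rightarrow> (real \<Rightarrow> real \<Rightarrow> real \<Rightarrow> real) \<Rightarrow> bool" where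
  "smooth3 T f \<longleftrightarrow> smooth_on ({0..T} \<times> UNIV) (\<lambda>(t, x, u). f t x u)"

lemma dt_cong:
  assumes "t \<in> {0..T}" and "\<And>s. s \<in> {0..T} \<Longrightarrow> f s = h s"
  shows "dt T f t = dt T h t"
proof -
  have "(f has_vector_derivative d) (at t within {0..T}) \<longleftrightarrow>
        (h has_vector_derivative d) (at t within {0..T})" for d
    using assms by (metis (no_types, lifting) has_vector_derivative_transform)
  then show ?thesis
    by (simp add: dt_def vector_derivative_def)
qed

lemma dt_eqI:
  assumes "t \<in> {0..T}" and "T > 0" and "(f has_real_derivative d) (at t within {0..T})"
  shows "dt T f t = d"
  unfolding dt_def
  using vector_derivative_within_cbox[of 0 T t f d] assms
  by (simp add: has_real_derivative_iff_has_vector_derivative)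

lemma smooth3_partials:
  assumes "smooth3 T f" and "T > 0"
  shows smooth3_has_dt: "\<And>t x u. t \<in> {0..T} \<Longrightarrow>
      ((\<lambda>s. f s x u) has_real_derivative dt T (\<lambda>s. f s x u) t) (at t within {0..T})"
    and smooth3_has_deriv_x: "\<And>t x u. t \<in> {0..T} \<Longrightarrow>
      ((\<lambda>v. f t v u) has_real_derivative deriv (\<lambda>v. f t v u) x) (at x)"
    and smooth3_has_deriv_u: "\<And>t x u. t \<in> {0..T} \<Longrightarrow>
      ((\<lambda>v. f t x v) has_real_derivative deriv (\<lambda>v. f t x v) u) (at u)"
    and smooth3_dt: "smooth3 T (\<lambda>t x u. dt T (\<lambda>s. f s x u) t)"
    and smooth3_deriv_x: "smooth3 T (\<lambda>t x u. deriv (\<lambda>v. f t v u) x)"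
    and smooth3_deriv_u: "smooth3 T (\<lambda>t x u. deriv (\<lambda>v. f t x v) u)"
proof -
  let ?S = "{0..T} \<times> UNIV :: (real \<times> real \<times> real) set"
  obtain f' where f': "\<And>p. p \<in> ?S \<Longrightarrow> ((\<lambda>(t, x, u). f t x u) has_derivative f' p) (at p within ?S)"
    and sm: "\<And>v. smooth_on ?S (\<lambda>p. f' p v)"
    using assms(1) unfolding smooth3_def by cases blast
  note pairs = has_vector_derivative_Pair[OF has_vector_derivative_id has_vector_derivative_const]
    has_vector_derivative_Pair[OF has_vector_derivative_const has_vector_derivative_id]
    has_vector_derivative_Pair[OF has_vector_derivative_const
      has_vector_derivative_Pair[OF has_vector_derivative_id has_vector_derivative_const]]
    has_vector_derivative_Pair[OF has_vector_derivative_const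
      has_vector_derivative_Pair[OF has_vector_derivative_const has_vector_derivative_id]]
  have t: "((\<lambda>s. f s x u) has_real_derivative f' (t, x, u) (1, 0, 0)) (at t within {0..T})"
    if "t \<in> {0..T}" for t x u
    using has_derivative_along_curve[OF f', where c = "\<lambda>s. (s, x, u)" and I = "{0..T}" and i = t
        and e = "(1, 0)"] that pairs(1)[of "(x, u)"]
    by (auto simp: zero_prod_def)
  have x: "((\<lambda>v. f t v u) has_real_derivative f' (t, x, u) (0, 1, 0)) (at x)"
    if "t \<in> {0..T}" for t x u
  proof -
    have "((\<lambda>v. (t, v, u)) has_vector_derivative (0, 1, 0)) (at x)"
      by (rule pairs)
    then show ?thesis
      using has_derivative_along_curve[OF f', where c = "\<lambda>v. (t, v, u)" and I = UNIV and i = x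
          and e = "(0, 1, 0)"] that by (auto simp: image_subset_iff)
  qed
  have u: "((\<lambda>v. f t x v) has_real_derivative f' (t, x, u) (0, 0, 1)) (at u)"
    if "t \<in> {0..T}" for t x u
  proof -
    have "((\<lambda>v. (t, x, v)) has_vector_derivative (0, 0, 1)) (at u)"
      by (rule pairs)
    then show ?thesis
      using has_derivative_along_curve[OF f', where c = "\<lambda>v. (t, x, v)" and I = UNIV and i = u
          and e = "(0, 0, 1)"] that by (auto simp: image_subset_iff)
  qed
  have t': "dt T (\<lambda>s. f s x u) t = f' (t, x, u) (1, 0, 0)" if "t \<in> {0..T}" for t x u
    using dt_eqI t that assms(2) by blast
  have x': "deriv (\<lambda>v. f t v u) x = f' (t, x, u) (0, 1, 0)" if "t \<in> {0..T}" for t x u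
    using DERIV_imp_deriv x that by blast
  have u': "deriv (\<lambda>v. f t x v) u = f' (t, x, u) (0, 0, 1)" if "t \<in> {0..T}" for t x u
    using DERIV_imp_deriv u that by blast
  show "((\<lambda>s. f s x u) has_real_derivative dt T (\<lambda>s. f s x u) t) (at t within {0..T})"
    if "t \<in> {0..T}" for t x u using t[OF that] t'[OF that] by metis
  show "((\<lambda>v. f t v u) has_real_derivative deriv (\<lambda>v. f t v u) x) (at x)"
    if "t \<in> {0..T}" for t x u using x[OF that] x'[OF that] by metis
  show "((\<lambda>v. f t x v) has_real_derivative deriv (\<lambda>v. f t x v) u) (at u)"
    if "t \<in> {0..T}" for t x u using u[OF that] u'[OF that] by metis
  show "smooth3 T (\<lambda>t x u. dt T (\<lambda>s. f s x u) t)"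
    unfolding smooth3_def by (rule smooth_on_cong[OF sm[of "(1, 0, 0)"]]) (auto simp: t')
  show "smooth3 T (\<lambda>t x u. deriv (\<lambda>v. f t v u) x)"
    unfolding smooth3_def by (rule smooth_on_cong[OF sm[of "(0, 1, 0)"]]) (auto simp: x')
  show "smooth3 T (\<lambda>t x u. deriv (\<lambda>v. f t x v) u)"
    unfolding smooth3_def by (rule smooth_on_cong[OF sm[of "(0, 0, 1)"]]) (auto simp: u')
qed

lemma smooth3_continuous_on:
  assumes "smooth3 T f"
  shows "continuous_on {0..T} (\<lambda>t. f t x u)"
proof -
  have "continuous_on {0..T} (\<lambda>t. (\<lambda>(t, x, u). f t x u) (t, x, u))"
    by (rule continuous_on_compose2[OF smooth_on_continuous_on])
       (use assms in \<open>auto simp: smooth3_def intro!: continuous_intros\<close>)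
  then show ?thesis by simp
qed

lemma continuous_zero_at_end:
  fixes f :: "real \<Rightarrow> real"
  assumes "continuous_on {0..T} f" and "T > 0" and "\<And>t. t \<in> {0..<T} \<Longrightarrow> f t = 0"
    and "t \<in> {0..T}"
  shows "f t = 0"
  using continuous_constant_on_closure[of "{0..<T}" f 0 t] assms by simp

lemma smooth3_of_two_args:
  assumes "smooth_on ({0..T} \<times> UNIV) (\<lambda>(t, x). f t x)"
  shows "smooth3 T (\<lambda>t x u. f t x)"
proof -
  have "smooth_on ({0..T} \<times> UNIV :: (real \<times> real \<times> real) set)
      (\<lambda>p. (\<lambda>(t, x). f t x) (fst p, fst (snd p)))"
    by (rule smooth_on_compose_affine[OF assms, where a = 0 and L = "\<lambda>p. (fst p, fst (snd p))"])
       (auto intro!: bounded_linear_intros simp: mem_Times_iff)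
  then show ?thesis
    by (simp add: smooth3_def case_prod_unfold)
qed

lemma smooth3_of_four_args:
  assumes "smooth_on ({0..T} \<times> UNIV) (\<lambda>(t, x, y, z). f t x y z)"
  shows "smooth3 T (\<lambda>t x u. f t x u z)"
proof -
  have "smooth_on ({0..T} \<times> UNIV :: (real \<times> real \<times> real) set)
      (\<lambda>p. (\<lambda>(t, x, y, z). f t x y z) (fst p, fst (snd p), snd (snd p), z))"
    by (rule smooth_on_compose_affine[OF assms, where a = "(0, 0, 0, z)"
          and L = "\<lambda>p. (fst p, fst (snd p), snd (snd p), 0)"])
       (auto intro!: bounded_linear_intros simp: mem_Times_iff)
  then show ?thesis
    by (simp add: smooth3_def case_prod_unfold)
qed

definition drift_Y where
  "drift_Y T b \<sigma> g \<tau> \<xi> \<eta> t x y z =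
          dt T (\<lambda>s. g s x y z * \<tau> s) t
          + deriv (\<lambda>v. g t v y z) x * \<xi> t x
          + deriv (\<lambda>w. g t x w z) y * \<eta> t x y
          + deriv (\<lambda>k. g t x y k) z *
              (\<sigma> t x * deriv (\<lambda>v. \<eta> t v y) x + (deriv (\<lambda>w. \<eta> t x w) y - 1/2 * dt T \<tau> t) * z)
          + dt T (\<lambda>s. \<eta> s x y) t
          + b t x * deriv (\<lambda>v. \<eta> t v y) x
          - g t x y z * deriv (\<lambda>w. \<eta> t x w) y
          + 1/2 * ((\<sigma> t x)\<^sup>2 * deriv (\<lambda>v. deriv (\<lambda>v'. \<eta> t v' y) v) x
                   + deriv (\<lambda>w. deriv (\<lambda>w'. \<eta> t x w') w) y * z\<^sup>2
                   + deriv (\<lambda>w. deriv (\<lambda>v. \<eta> t v w) x) y * \<sigma> t x * (z::real))"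

definition drift_X where
  "drift_X T b \<sigma> \<tau> \<xi> t x =
          dt T (\<lambda>s. \<xi> s x) t + 1/2 * (\<sigma> t x)\<^sup>2 * deriv (\<lambda>v. deriv (\<lambda>v'. \<xi> t v') v) x
          + b t x * deriv (\<lambda>v. \<xi> t v) x - deriv (\<lambda>v. b t v) x * \<xi> t x
          - dt T (\<lambda>s. b s x * \<tau> s) t"

definition diffusion_X where
  "diffusion_X T \<sigma> \<tau> \<xi> t x =
          - \<sigma> t x * deriv (\<lambda>v. \<xi> t v) x + deriv (\<lambda>v. \<sigma> t v) x * \<xi> t x
          + 1/2 * \<sigma> t x * dt T \<tau> t + dt T (\<lambda>s. \<sigma> s x) t * \<tau> t"

lemma smooth_vec_field_iff:
  "smooth_vec_field T (\<theta>, \<gamma>, \<phi>) \<longleftrightarrow> smooth3 T \<theta> \<and> smooth3 T \<gamma> \<and> smooth3 T \<phi>"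
  by (simp add: smooth_vec_field_def smooth3_def)

lemma DERIV_zero_const:
  fixes f :: "real \<Rightarrow> real"
  assumes "\<And>x. (f has_real_derivative 0) (at x)"
  shows "f x = f y"
  using DERIV_isconst_all assms by blast

locale semilinear_problem =
  fixes T :: real
    and b \<sigma> :: "real \<Rightarrow> real \<Rightarrow> real"
    and g :: "real \<Rightarrow> real \<Rightarrow> real \<Rightarrow> real \<Rightarrow> real"
    and H :: "real \<Rightarrow> real"
  assumes T_pos: "T > 0"
    and coeffs: "smooth_coefficients T b \<sigma> g H"
    and sigma_nz: "\<And>t x. t \<in> {0..T} \<Longrightarrow> \<sigma> t x \<noteq> 0"
    and g_indep: "\<And>t x y z z'. t \<in> {0..T} \<Longrightarrow> g t x y z = g t x y z'"
begin

lemma smooth_b: "smooth3 T (\<lambda>t x u. b t x)"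
  and smooth_sigma: "smooth3 T (\<lambda>t x u. \<sigma> t x)"
  and smooth_g: "smooth3 T (\<lambda>t x u. g t x u 0)"
  using coeffs unfolding smooth_coefficients_def
  by (auto intro: smooth3_of_two_args smooth3_of_four_args)

lemmas has_dt = smooth3_has_dt[OF _ T_pos]
lemmas has_deriv_x = smooth3_has_deriv_x[OF _ T_pos]
lemmas has_deriv_u = smooth3_has_deriv_u[OF _ T_pos]
lemmas smooth_dt = smooth3_dt[OF _ T_pos]
lemmas smooth_deriv_x = smooth3_deriv_x[OF _ T_pos]
lemmas smooth_deriv_u = smooth3_deriv_u[OF _ T_pos]

lemma L_FBSDE_iff:
  "(\<theta>, \<gamma>, \<eta>) \<in> L_FBSDE T b \<sigma> g H \<longleftrightarrow>
     smooth3 T \<theta> \<and> smooth3 T \<gamma> \<and> smooth3 T \<eta> \<and>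
     (\<forall>t\<in>{0..T}. \<forall>x u. \<theta> t x u = \<theta> t 0 0 \<and> \<gamma> t x u = \<gamma> t x 0) \<and>
     (\<forall>t\<in>{0..T}. \<forall>x y z. drift_Y T b \<sigma> g (\<lambda>t. \<theta> t 0 0) (\<lambda>t x. \<gamma> t x 0) \<eta> t x y z = 0) \<and>
     (\<forall>t\<in>{0..T}. \<forall>x. drift_X T b \<sigma> (\<lambda>t. \<theta> t 0 0) (\<lambda>t x. \<gamma> t x 0) t x = 0) \<and>
     (\<forall>t\<in>{0..T}. \<forall>x. diffusion_X T \<sigma> (\<lambda>t. \<theta> t 0 0) (\<lambda>t x. \<gamma> t x 0) t x = 0) \<and>
     (\<forall>t\<in>{0..T}. \<forall>x. \<eta> t x (H x) = deriv H x * \<gamma> t x (H x))"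
  (is "?lhs \<longleftrightarrow> ?rhs")
proof -
  have unfold: "?lhs \<longleftrightarrow> (smooth3 T \<theta> \<and> smooth3 T \<gamma> \<and> smooth3 T \<eta>) \<and> (\<exists>\<tau> \<xi>.
     (\<forall>t\<in>{0..T}. \<forall>x y. \<theta> t x y = \<tau> t \<and> \<gamma> t x y = \<xi> t x) \<and>
     (\<forall>t\<in>{0..T}. \<forall>x y z. drift_Y T b \<sigma> g \<tau> \<xi> \<eta> t x y z = 0) \<and>
     (\<forall>t\<in>{0..T}. \<forall>x. drift_X T b \<sigma> \<tau> \<xi> t x = 0) \<and>
     (\<forall>t\<in>{0..T}. \<forall>x. diffusion_X T \<sigma> \<tau> \<xi> t x = 0) \<and>
     (\<forall>t\<in>{0..T}. \<forall>x. \<eta> t x (H x) = deriv H x * \<xi> t x))"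
    unfolding L_FBSDE_def drift_Y_def drift_X_def diffusion_X_def mem_Collect_eq prod.case
      smooth_vec_field_iff by (rule refl)
  show ?thesis
  proof
    assume rhs: ?rhs
    then have "\<theta> t x y = \<theta> t 0 0" "\<gamma> t x y = \<gamma> t x 0" if "t \<in> {0..T}" for t x y
      using that by blast+
    with rhs show ?lhs
      unfolding unfold
      by (intro conjI exI[of _ "\<lambda>t. \<theta> t 0 0"] exI[of _ "\<lambda>t x. \<gamma> t x 0"]) (metis | blast)+
  next
    assume ?lhs
    then obtain \<tau> \<xi> where
      sm: "smooth3 T \<theta>" "smooth3 T \<gamma>" "smooth3 T \<eta>"
      and proj: "\<And>t x y. t \<in> {0..T} \<Longrightarrow> \<theta> t x y = \<tau> t" "\<And>t x y. t \<in> {0..T} \<Longrightarrow> \<gamma> t x y = \<xi> t x"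
      and eqs: "\<And>t x y z. t \<in> {0..T} \<Longrightarrow> drift_Y T b \<sigma> g \<tau> \<xi> \<eta> t x y z = 0"
        "\<And>t x. t \<in> {0..T} \<Longrightarrow> drift_X T b \<sigma> \<tau> \<xi> t x = 0"
        "\<And>t x. t \<in> {0..T} \<Longrightarrow> diffusion_X T \<sigma> \<tau> \<xi> t x = 0"
      and terminal: "\<And>t x. t \<in> {0..T} \<Longrightarrow> \<eta> t x (H x) = deriv H x * \<xi> t x"
      unfolding unfold by auto
    have dts: "dt T (\<lambda>s. \<theta> s 0 0) t = dt T \<tau> t" "dt T (\<lambda>s. \<gamma> s x 0) t = dt T (\<lambda>s. \<xi> s x) t"
      "dt T (\<lambda>s. c s * \<theta> s 0 0) t = dt T (\<lambda>s. c s * \<tau> s) t" if "t \<in> {0..T}" for t x c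
      using that proj by (auto intro!: dt_cong)
    have "drift_Y T b \<sigma> g (\<lambda>t. \<theta> t 0 0) (\<lambda>t x. \<gamma> t x 0) \<eta> t x y z = 0"
      "drift_X T b \<sigma> (\<lambda>t. \<theta> t 0 0) (\<lambda>t x. \<gamma> t x 0) t x = 0"
      "diffusion_X T \<sigma> (\<lambda>t. \<theta> t 0 0) (\<lambda>t x. \<gamma> t x 0) t x = 0"
      if "t \<in> {0..T}" for t x y z
      using eqs[OF that] unfolding drift_Y_def drift_X_def diffusion_X_def dts[OF that] proj[OF that]
      by blast+
    then show ?rhs
      using sm proj terminal by simp
  qed
qed

lemma PDE_lhs_eq:
  assumes "t \<in> {0..T}"
  shows "PDE_lhs b \<sigma> g t x u p q r s w
    = p + b t x * q + 1/2 * (\<sigma> t x)\<^sup>2 * w + g t x u 0"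
  unfolding PDE_lhs_def using g_indep[OF assms] by metis

lemma PDE_lhs_derivs:
  assumes t: "t \<in> {0..T}"
  shows "dt T (\<lambda>t'. PDE_lhs b \<sigma> g t' x u p q r s w) t
      = dt T (\<lambda>t'. b t' x) t * q + \<sigma> t x * dt T (\<lambda>t'. \<sigma> t' x) t * w + dt T (\<lambda>t'. g t' x u 0) t"
    and "deriv (\<lambda>x'. PDE_lhs b \<sigma> g t x' u p q r s w) x
      = deriv (b t) x * q + \<sigma> t x * deriv (\<sigma> t) x * w + deriv (\<lambda>x'. g t x' u 0) x"
    and "deriv (\<lambda>u'. PDE_lhs b \<sigma> g t x u' p q r s w) u = deriv (\<lambda>u'. g t x u' 0) u"
    and "deriv (\<lambda>p'. PDE_lhs b \<sigma> g t x u p' q r s w) p = 1"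
    and "deriv (\<lambda>q'. PDE_lhs b \<sigma> g t x u p q' r s w) q = b t x"
    and "deriv (\<lambda>r'. PDE_lhs b \<sigma> g t x u p q r' s w) r = 0"
    and "deriv (\<lambda>s'. PDE_lhs b \<sigma> g t x u p q r s' w) s = 0"
    and "deriv (\<lambda>w'. PDE_lhs b \<sigma> g t x u p q r s w') w = 1/2 * (\<sigma> t x)\<^sup>2"
proof -
  note bs = has_dt[OF smooth_b t, of x] has_dt[OF smooth_sigma t, of x] has_dt[OF smooth_g t, of x u]
    has_deriv_x[OF smooth_b t, of x] has_deriv_x[OF smooth_sigma t, of x]
    has_deriv_x[OF smooth_g t, of u x] has_deriv_u[OF smooth_g t, of x u]
  have "dt T (\<lambda>t'. PDE_lhs b \<sigma> g t' x u p q r s w) t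
      = dt T (\<lambda>t'. p + b t' x * q + 1/2 * (\<sigma> t' x)\<^sup>2 * w + g t' x u 0) t"
    using t by (intro dt_cong) (auto simp: PDE_lhs_eq)
  also have "\<dots> = dt T (\<lambda>t'. b t' x) t * q + \<sigma> t x * dt T (\<lambda>t'. \<sigma> t' x) t * w + dt T (\<lambda>t'. g t' x u 0) t"
    by (rule dt_eqI[OF t T_pos]) (auto intro!: derivative_eq_intros bs)
  finally show "dt T (\<lambda>t'. PDE_lhs b \<sigma> g t' x u p q r s w) t
      = dt T (\<lambda>t'. b t' x) t * q + \<sigma> t x * dt T (\<lambda>t'. \<sigma> t' x) t * w + dt T (\<lambda>t'. g t' x u 0) t" .
  show "deriv (\<lambda>w'. PDE_lhs b \<sigma> g t x u p q r s w') w = 1/2 * (\<sigma> t x)\<^sup>2"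
    unfolding PDE_lhs_eq[OF t] by (rule DERIV_imp_deriv) (auto intro!: derivative_eq_intros)
qed (use t in \<open>auto simp: PDE_lhs_eq intro!: DERIV_imp_deriv derivative_eq_intros
      has_deriv_x[OF smooth_b t] has_deriv_x[OF smooth_sigma t]
      has_deriv_x[OF smooth_g t] has_deriv_u[OF smooth_g t]\<close>)

lemma pr2_PDE_lhs:
  assumes "t \<in> {0..T}"
  shows "pr2 T (\<theta>, \<gamma>, \<phi>) (PDE_lhs b \<sigma> g) t x u p q r s w =
    \<theta> t x u * (dt T (\<lambda>t'. b t' x) t * q + \<sigma> t x * dt T (\<lambda>t'. \<sigma> t' x) t * w + dt T (\<lambda>t'. g t' x u 0) t)
    + \<gamma> t x u * (deriv (b t) x * q + \<sigma> t x * deriv (\<sigma> t) x * w + deriv (\<lambda>x'. g t x' u 0) x)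
    + \<phi> t x u * deriv (\<lambda>u'. g t x u' 0) u
    + prol_t T (\<theta>, \<gamma>, \<phi>) t x u p q + prol_x (\<theta>, \<gamma>, \<phi>) t x u p q * b t x
    + prol_xx (\<theta>, \<gamma>, \<phi>) t x u p q s w * (1/2 * (\<sigma> t x)\<^sup>2)"
  unfolding pr2_def prod.case PDE_lhs_derivs[OF assms] by simp

end

locale affine_vec_field = semilinear_problem +
  fixes \<theta> \<gamma> \<phi> :: "real \<Rightarrow> real \<Rightarrow> real \<Rightarrow> real"
    and \<tau> \<delta> :: "real \<Rightarrow> real" and \<xi> \<beta> :: "real \<Rightarrow> real \<Rightarrow> real"
  defines "\<tau> \<equiv> \<lambda>t. \<theta> t 0 0" and "\<xi> \<equiv> \<lambda>t x. \<gamma> t x 0"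
    and "\<delta> \<equiv> \<lambda>t. \<phi> t 0 1 - \<phi> t 0 0" and "\<beta> \<equiv> \<lambda>t x. \<phi> t x 0"
  assumes smooth_theta: "smooth3 T \<theta>" and smooth_gamma: "smooth3 T \<gamma>" and smooth_phi: "smooth3 T \<phi>"
    and theta: "\<And>t x u. t \<in> {0..T} \<Longrightarrow> \<theta> t x u = \<tau> t"
    and gamma: "\<And>t x u. t \<in> {0..T} \<Longrightarrow> \<gamma> t x u = \<xi> t x"
    and phi: "\<And>t x u. t \<in> {0..T} \<Longrightarrow> \<phi> t x u = \<delta> t * u + \<beta> t x"
begin

lemma component_derivs:
  assumes "t \<in> {0..T}"
  shows has_dt_tau: "(\<tau> has_real_derivative dt T \<tau> t) (at t within {0..T})"
    and has_dt_beta: "((\<lambda>s. \<beta> s x) has_real_derivative dt T (\<lambda>s. \<beta> s x) t) (at t within {0..T})"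
    and has_dt_delta: "(\<delta> has_real_derivative dt T \<delta> t) (at t within {0..T})"
    and has_deriv_beta: "(\<beta> t has_real_derivative deriv (\<beta> t) x) (at x)"
    and has_deriv2_xi: "(deriv (\<xi> t) has_real_derivative deriv (deriv (\<xi> t)) x) (at x)"
    and has_deriv2_beta: "(deriv (\<beta> t) has_real_derivative deriv (deriv (\<beta> t)) x) (at x)"
proof -
  note t = assms
  show "(\<tau> has_real_derivative dt T \<tau> t) (at t within {0..T})"
    "((\<lambda>s. \<beta> s x) has_real_derivative dt T (\<lambda>s. \<beta> s x) t) (at t within {0..T})"
    "(\<beta> t has_real_derivative deriv (\<beta> t) x) (at x)"
    unfolding \<tau>_def \<beta>_def
    by (rule has_dt has_deriv_x smooth_theta smooth_phi t)+
  have d: "(\<delta> has_real_derivative dt T (\<lambda>s. \<phi> s 0 1) t - dt T (\<lambda>s. \<phi> s 0 0) t) (at t within {0..T})"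
    unfolding \<delta>_def by (intro DERIV_diff has_dt smooth_phi t)
  then show "(\<delta> has_real_derivative dt T \<delta> t) (at t within {0..T})"
    using dt_eqI[OF t T_pos d] by simp
  show "(deriv (\<xi> t) has_real_derivative deriv (deriv (\<xi> t)) x) (at x)"
    "(deriv (\<beta> t) has_real_derivative deriv (deriv (\<beta> t)) x) (at x)"
    unfolding \<xi>_def \<beta>_def
    using has_deriv_x[OF smooth_deriv_x[OF smooth_gamma] t, of 0 x]
      has_deriv_x[OF smooth_deriv_x[OF smooth_phi] t, of 0 x]
    by simp_all
qed

lemma sections:
  assumes "t \<in> {0..T}"
  shows "\<theta> t = (\<lambda>x u. \<tau> t)" and "\<gamma> t = (\<lambda>x u. \<xi> t x)" and "\<phi> t = (\<lambda>x u. \<delta> t * u + \<beta> t x)"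
  using theta gamma phi assms by blast+

lemma time_derivs:
  assumes t: "t \<in> {0..T}"
  shows "dt T (\<lambda>s. \<theta> s x u) t = dt T \<tau> t"
    and "dt T (\<lambda>s. \<gamma> s x u) t = dt T (\<lambda>s. \<xi> s x) t"
    and "dt T (\<lambda>s. \<phi> s x u) t = dt T \<delta> t * u + dt T (\<lambda>s. \<beta> s x) t"
proof -
  show "dt T (\<lambda>s. \<theta> s x u) t = dt T \<tau> t" "dt T (\<lambda>s. \<gamma> s x u) t = dt T (\<lambda>s. \<xi> s x) t"
    using t theta gamma by (auto intro!: dt_cong)
  have "dt T (\<lambda>s. \<phi> s x u) t = dt T (\<lambda>s. \<delta> s * u + \<beta> s x) t"
    using t phi by (auto intro!: dt_cong)
  also have "\<dots> = dt T \<delta> t * u + dt T (\<lambda>s. \<beta> s x) t"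
    by (rule dt_eqI[OF t T_pos])
       (auto intro!: derivative_eq_intros has_dt_delta[OF t] has_dt_beta[OF t])
  finally show "dt T (\<lambda>s. \<phi> s x u) t = dt T \<delta> t * u + dt T (\<lambda>s. \<beta> s x) t" .
qed

lemma space_derivs:
  assumes t: "t \<in> {0..T}"
  shows "deriv (\<lambda>x. \<theta> t x u) = (\<lambda>x. 0)" and "deriv (\<lambda>u. \<theta> t x u) = (\<lambda>u. 0)"
    and "deriv (\<lambda>x. \<gamma> t x u) = deriv (\<xi> t)" and "deriv (\<lambda>u. \<gamma> t x u) = (\<lambda>u. 0)"
    and "deriv (\<lambda>x. \<phi> t x u) = deriv (\<beta> t)" and "deriv (\<lambda>u. \<phi> t x u) = (\<lambda>u. \<delta> t)"
  unfolding sections[OF t]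
  by (auto intro!: ext DERIV_imp_deriv derivative_eq_intros has_deriv_beta[OF t])

lemma prol_x_eq:
  assumes "t \<in> {0..T}"
  shows "prol_x (\<theta>, \<gamma>, \<phi>) t = (\<lambda>x u p q. deriv (\<beta> t) x + \<delta> t * q - deriv (\<xi> t) x * q)"
  unfolding prol_x_def prod.case Dx0_def space_derivs[OF assms]
  by (simp add: fun_eq_iff algebra_simps)

lemma prol_t_eq:
  assumes "t \<in> {0..T}"
  shows "prol_t T (\<theta>, \<gamma>, \<phi>) t x u p q = dt T \<delta> t * u + dt T (\<lambda>s. \<beta> s x) t + \<delta> t * p
    - dt T \<tau> t * p - dt T (\<lambda>s. \<xi> s x) t * q"
  unfolding prol_t_def prod.case Dt0_def space_derivs[OF assms] time_derivs[OF assms]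
  by (simp add: algebra_simps)

lemma prol_xx_eq:
  assumes t: "t \<in> {0..T}"
  shows "prol_xx (\<theta>, \<gamma>, \<phi>) t x u p q s w
    = deriv (deriv (\<beta> t)) x - deriv (deriv (\<xi> t)) x * q + (\<delta> t - 2 * deriv (\<xi> t) x) * w"
proof -
  have "deriv (\<lambda>x. deriv (\<beta> t) x + \<delta> t * q - deriv (\<xi> t) x * q) x
      = deriv (deriv (\<beta> t)) x - deriv (deriv (\<xi> t)) x * q"
    by (auto intro!: DERIV_imp_deriv derivative_eq_intros has_deriv2_beta[OF t] has_deriv2_xi[OF t])
  moreover have "deriv (\<lambda>q. deriv (\<beta> t) x + \<delta> t * q - deriv (\<xi> t) x * q) q = \<delta> t - deriv (\<xi> t) x"
    by (auto intro!: DERIV_imp_deriv derivative_eq_intros)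
  ultimately show ?thesis
    unfolding prol_xx_def prod.case Dx1_def Dx0_def prol_x_eq[OF t] space_derivs[OF t]
    by (simp only: deriv_const) (simp add: algebra_simps)
qed

lemma dt_product:
  assumes t: "t \<in> {0..T}"
  shows "dt T (\<lambda>s. b s x * \<tau> s) t = dt T (\<lambda>s. b s x) t * \<tau> t + b t x * dt T \<tau> t"
    and "dt T (\<lambda>s. g s x u z * \<tau> s) t = dt T (\<lambda>s. g s x u 0) t * \<tau> t + g t x u 0 * dt T \<tau> t"
proof -
  show "dt T (\<lambda>s. b s x * \<tau> s) t = dt T (\<lambda>s. b s x) t * \<tau> t + b t x * dt T \<tau> t"
    by (rule dt_eqI[OF t T_pos])
       (auto intro!: derivative_eq_intros has_dt_tau[OF t] has_dt[OF smooth_b t])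
  have "dt T (\<lambda>s. g s x u z * \<tau> s) t = dt T (\<lambda>s. g s x u 0 * \<tau> s) t"
    using t g_indep by (intro dt_cong) auto
  also have "\<dots> = dt T (\<lambda>s. g s x u 0) t * \<tau> t + g t x u 0 * dt T \<tau> t"
    by (rule dt_eqI[OF t T_pos])
       (auto intro!: derivative_eq_intros has_dt_tau[OF t] has_dt[OF smooth_g t])
  finally show "dt T (\<lambda>s. g s x u z * \<tau> s) t = dt T (\<lambda>s. g s x u 0) t * \<tau> t + g t x u 0 * dt T \<tau> t" .
qed

lemma drift_Y_eq:
  assumes t: "t \<in> {0..T}"
  shows "drift_Y T b \<sigma> g \<tau> \<xi> \<phi> t x u z =
    dt T (\<lambda>s. g s x u 0) t * \<tau> t + g t x u 0 * dt T \<tau> t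
    + deriv (\<lambda>v. g t v u 0) x * \<xi> t x + deriv (\<lambda>w. g t x w 0) u * \<phi> t x u
    + dt T \<delta> t * u + dt T (\<lambda>s. \<beta> s x) t + b t x * deriv (\<beta> t) x - g t x u 0 * \<delta> t
    + 1/2 * (\<sigma> t x)\<^sup>2 * deriv (deriv (\<beta> t)) x"
proof -
  have g0: "g t x u = (\<lambda>z. g t x u 0)" "(\<lambda>v. g t v u z) = (\<lambda>v. g t v u 0)"
      "(\<lambda>w. g t x w z) = (\<lambda>w. g t x w 0)" "g t x u z = g t x u 0"
    using g_indep[OF t] by blast+
  have "drift_Y T b \<sigma> g \<tau> \<xi> \<phi> t x u z =
    dt T (\<lambda>s. g s x u z * \<tau> s) t
    + deriv (\<lambda>v. g t v u 0) x * \<xi> t x + deriv (\<lambda>w. g t x w 0) u * \<phi> t x u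
    + dt T \<delta> t * u + dt T (\<lambda>s. \<beta> s x) t + b t x * deriv (\<beta> t) x - g t x u 0 * \<delta> t
    + 1/2 * (\<sigma> t x)\<^sup>2 * deriv (deriv (\<beta> t)) x"
    unfolding drift_Y_def space_derivs[OF t] time_derivs[OF t]
    unfolding g0(2-4) by (subst g0(1)) simp
  then show ?thesis
    unfolding dt_product[OF t] by simp
qed

lemma pr2_eq_determining:
  assumes t: "t \<in> {0..T}"
  shows "pr2 T (\<theta>, \<gamma>, \<phi>) (PDE_lhs b \<sigma> g) t x u p q r s w =
    (\<delta> t - dt T \<tau> t) * PDE_lhs b \<sigma> g t x u p q r s w
    + drift_Y T b \<sigma> g \<tau> \<xi> \<phi> t x u 0 - q * drift_X T b \<sigma> \<tau> \<xi> t x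
    + w * \<sigma> t x * diffusion_X T \<sigma> \<tau> \<xi> t x"
  unfolding pr2_PDE_lhs[OF t] PDE_lhs_eq[OF t] prol_x_eq[OF t] prol_t_eq[OF t] prol_xx_eq[OF t]
    drift_Y_eq[OF t] drift_X_def diffusion_X_def dt_product[OF t] theta[OF t] gamma[OF t]
  by (simp add: algebra_simps power2_eq_square add_divide_distrib diff_divide_distrib)

lemma determining_continuous:
  shows "continuous_on {0..T} (\<lambda>t. drift_Y T b \<sigma> g \<tau> \<xi> \<phi> t x u z)"
    and "continuous_on {0..T} (\<lambda>t. drift_X T b \<sigma> \<tau> \<xi> t x)"
    and "continuous_on {0..T} (\<lambda>t. diffusion_X T \<sigma> \<tau> \<xi> t x)"
proof -
  note c = smooth3_continuous_on
  have tau: "continuous_on {0..T} \<tau>" "continuous_on {0..T} (dt T \<tau>)"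
    unfolding \<tau>_def using c[OF smooth_theta] c[OF smooth_dt[OF smooth_theta]] by auto
  have xi: "continuous_on {0..T} (\<lambda>t. \<xi> t x)" "continuous_on {0..T} (\<lambda>t. dt T (\<lambda>s. \<xi> s x) t)"
    "continuous_on {0..T} (\<lambda>t. deriv (\<xi> t) x)" "continuous_on {0..T} (\<lambda>t. deriv (deriv (\<xi> t)) x)" for x
    unfolding \<xi>_def using c[OF smooth_gamma] c[OF smooth_dt[OF smooth_gamma]]
      c[OF smooth_deriv_x[OF smooth_gamma]] c[OF smooth_deriv_x[OF smooth_deriv_x[OF smooth_gamma]]]
    by auto
  have beta: "continuous_on {0..T} (\<lambda>t. \<beta> t x)" "continuous_on {0..T} (\<lambda>t. dt T (\<lambda>s. \<beta> s x) t)"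
    "continuous_on {0..T} (\<lambda>t. deriv (\<beta> t) x)" "continuous_on {0..T} (\<lambda>t. deriv (deriv (\<beta> t)) x)" for x
    unfolding \<beta>_def using c[OF smooth_phi] c[OF smooth_dt[OF smooth_phi]]
      c[OF smooth_deriv_x[OF smooth_phi]] c[OF smooth_deriv_x[OF smooth_deriv_x[OF smooth_phi]]]
    by auto
  have delta: "continuous_on {0..T} \<delta>"
    unfolding \<delta>_def by (intro continuous_intros c smooth_phi)
  have "continuous_on {0..T} (\<lambda>t. dt T (\<lambda>s. \<phi> s 0 1) t - dt T (\<lambda>s. \<phi> s 0 0) t)"
    using c[OF smooth_dt[OF smooth_phi]] by (intro continuous_intros)
  then have ddelta: "continuous_on {0..T} (dt T \<delta>)"
    by (rule continuous_on_eq) (simp add: time_derivs)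
  have b: "continuous_on {0..T} (\<lambda>t. b t x)" "continuous_on {0..T} (\<lambda>t. dt T (\<lambda>s. b s x) t)"
    "continuous_on {0..T} (\<lambda>t. deriv (b t) x)" for x
    using c[OF smooth_b] c[OF smooth_dt[OF smooth_b]] c[OF smooth_deriv_x[OF smooth_b]] by auto
  have "continuous_on {0..T} (\<lambda>t. dt T (\<lambda>s. b s x) t * \<tau> t + b t x * dt T \<tau> t)" for x
    by (intro continuous_intros tau b)
  then have bt: "continuous_on {0..T} (\<lambda>t. dt T (\<lambda>s. b s x * \<tau> s) t)" for x
    by (rule continuous_on_eq) (simp add: dt_product)
  have sg: "continuous_on {0..T} (\<lambda>t. \<sigma> t x)" "continuous_on {0..T} (\<lambda>t. dt T (\<lambda>s. \<sigma> s x) t)"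
    "continuous_on {0..T} (\<lambda>t. deriv (\<sigma> t) x)" for x
    using c[OF smooth_sigma] c[OF smooth_dt[OF smooth_sigma]] c[OF smooth_deriv_x[OF smooth_sigma]] by auto
  have g: "continuous_on {0..T} (\<lambda>t. g t x u 0)" "continuous_on {0..T} (\<lambda>t. dt T (\<lambda>s. g s x u 0) t)"
    "continuous_on {0..T} (\<lambda>t. deriv (\<lambda>v. g t v u 0) x)"
    "continuous_on {0..T} (\<lambda>t. deriv (\<lambda>w. g t x w 0) u)" for x u
    using c[OF smooth_g] c[OF smooth_dt[OF smooth_g]] c[OF smooth_deriv_x[OF smooth_g]]
      c[OF smooth_deriv_u[OF smooth_g]] by auto
  show "continuous_on {0..T} (\<lambda>t. drift_Y T b \<sigma> g \<tau> \<xi> \<phi> t x u z)"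
    by (rule continuous_on_eq[rotated, OF drift_Y_eq[symmetric]])
       (auto intro!: continuous_intros tau xi beta delta ddelta b sg g c[OF smooth_phi])
  show "continuous_on {0..T} (\<lambda>t. drift_X T b \<sigma> \<tau> \<xi> t x)"
    unfolding drift_X_def
    by (intro continuous_intros tau xi b sg bt)
  show "continuous_on {0..T} (\<lambda>t. diffusion_X T \<sigma> \<tau> \<xi> t x)"
    unfolding diffusion_X_def by (auto intro!: continuous_intros tau xi sg)
qed

end

context semilinear_problem
begin

lemma continuous_extension_zero:
  assumes "smooth3 T f" and "\<And>t. t \<in> {0..<T} \<Longrightarrow> f t x u = 0" and "t \<in> {0..T}"
  shows "f t x u = 0"
  using continuous_zero_at_end[OF smooth3_continuous_on[OF assms(1)] T_pos assms(2,3)] .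

text \<open>The jet coordinate \<open>s = u\<^sub>t\<^sub>x\<close> is free on \<open>\<Delta> = 0\<close>, so invariance forces \<open>D\<^sub>x \<theta> = 0\<close>.\<close>

lemma prol_xx_diff_s:
  "prol_xx (\<theta>, \<gamma>, \<phi>) t x u p q 1 w - prol_xx (\<theta>, \<gamma>, \<phi>) t x u p q 0 w = - 2 * Dx0 \<theta> t x u q"
proof -
  have "deriv (\<lambda>p'. prol_x (\<theta>, \<gamma>, \<phi>) t x u p' q) p = - Dx0 \<theta> t x u q"
    unfolding prol_x_def prod.case by (rule DERIV_imp_deriv) (auto intro!: derivative_eq_intros)
  then show ?thesis
    unfolding prol_xx_def prod.case Dx1_def by (simp add: algebra_simps)
qed

lemma theta_projectable:
  assumes smooth: "smooth3 T \<theta>"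
    and inv: "\<And>t x u p q r s w. \<lbrakk>t \<in> {0..<T}; PDE_lhs b \<sigma> g t x u p q r s w = 0\<rbrakk> \<Longrightarrow>
        pr2 T (\<theta>, \<gamma>, \<phi>) (PDE_lhs b \<sigma> g) t x u p q r s w = 0"
    and t: "t \<in> {0..T}"
  shows "\<theta> t x u = \<theta> t 0 0"
proof -
  have Dx0: "Dx0 \<theta> t x u q = 0" if t: "t \<in> {0..<T}" for t x u q
  proof -
    have t': "t \<in> {0..T}" using t by simp
    define p where "p = - b t x * q - g t x u 0"
    have "PDE_lhs b \<sigma> g t x u p q 0 s 0 = 0" for s
      by (simp add: PDE_lhs_eq[OF t'] p_def)
    then have "pr2 T (\<theta>, \<gamma>, \<phi>) (PDE_lhs b \<sigma> g) t x u p q 0 1 0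
        - pr2 T (\<theta>, \<gamma>, \<phi>) (PDE_lhs b \<sigma> g) t x u p q 0 0 0 = 0"
      using inv[OF t] by simp
    then have "(prol_xx (\<theta>, \<gamma>, \<phi>) t x u p q 1 0 - prol_xx (\<theta>, \<gamma>, \<phi>) t x u p q 0 0)
        * (1/2 * (\<sigma> t x)\<^sup>2) = 0"
      unfolding pr2_PDE_lhs[OF t'] by (simp add: left_diff_distrib)
    then show ?thesis
      using sigma_nz[OF t'] by (simp add: prol_xx_diff_s)
  qed
  have x0: "deriv (\<lambda>x. \<theta> t x u) x = 0" if "t \<in> {0..<T}" for t x u
    using Dx0[OF that, of x u 0] by (simp add: Dx0_def)
  have u0: "deriv (\<lambda>u. \<theta> t x u) u = 0" if "t \<in> {0..<T}" for t x u
    using Dx0[OF that, of x u 1] x0[OF that] by (simp add: Dx0_def)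
  have x0': "deriv (\<lambda>x. \<theta> t x u) x = 0" for x u
    by (rule continuous_extension_zero[OF smooth_deriv_x[OF smooth] x0 t])
  have u0': "deriv (\<lambda>u. \<theta> t x u) u = 0" for x u
    by (rule continuous_extension_zero[OF smooth_deriv_u[OF smooth] u0 t])
  have "\<theta> t x u = \<theta> t 0 u"
    using has_deriv_x[OF smooth t] unfolding x0' by (rule DERIV_zero_const)
  also have "\<dots> = \<theta> t 0 0"
    using has_deriv_u[OF smooth t] unfolding u0' by (rule DERIV_zero_const)
  finally show ?thesis .
qed

text \<open>Varying \<open>w = u\<^sub>x\<^sub>x\<close>, with \<open>p = u\<^sub>t\<close> adjusted to stay on the equation, the coefficient of \<open>q w\<close>
  is \<open>- \<sigma>\<^sup>2 \<gamma>\<^sub>u\<close>.\<close>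

lemma gamma_projectable:
  assumes smooth: "smooth3 T \<gamma>"
    and theta: "\<And>t x u. t \<in> {0..T} \<Longrightarrow> \<theta> t x u = \<theta> t 0 0"
    and inv: "\<And>t x u p q r s w. \<lbrakk>t \<in> {0..<T}; PDE_lhs b \<sigma> g t x u p q r s w = 0\<rbrakk> \<Longrightarrow>
        pr2 T (\<theta>, \<gamma>, \<phi>) (PDE_lhs b \<sigma> g) t x u p q r s w = 0"
    and t: "t \<in> {0..T}"
  shows "\<gamma> t x u = \<gamma> t x 0"
proof -
  have u0: "deriv (\<lambda>u. \<gamma> t x u) u = 0" if t: "t \<in> {0..<T}" for t x u
  proof -
    have t': "t \<in> {0..T}" using t by simp
    have th: "\<theta> t = (\<lambda>x u. \<theta> t 0 0)"
      using theta[OF t'] by blast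
    have theta_derivs: "deriv (\<lambda>x. \<theta> t x u) x = 0" "deriv (\<lambda>u. \<theta> t x u) u = 0" for x u
      by (subst th, simp)+
    define \<gamma>x \<gamma>u \<phi>u where "\<gamma>x = deriv (\<lambda>x. \<gamma> t x u) x" and "\<gamma>u = deriv (\<lambda>u. \<gamma> t x u) u"
      and "\<phi>u = deriv (\<lambda>u. \<phi> t x u) u"
    define p where "p q w = - b t x * q - 1/2 * (\<sigma> t x)\<^sup>2 * w - g t x u 0" for q w
    have prol_x: "prol_x (\<theta>, \<gamma>, \<phi>) t x u p q
        = deriv (\<lambda>x. \<phi> t x u) x + q * deriv (\<lambda>u. \<phi> t x u) u
          - (deriv (\<lambda>x. \<gamma> t x u) x + q * deriv (\<lambda>u. \<gamma> t x u) u) * q" for x u p q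
      unfolding prol_x_def prod.case Dx0_def theta_derivs by simp
    have dq: "deriv (\<lambda>q'. prol_x (\<theta>, \<gamma>, \<phi>) t x u p q') q = \<phi>u - \<gamma>x - 2 * \<gamma>u * q" for p q
      unfolding prol_x \<gamma>x_def \<gamma>u_def \<phi>u_def
      by (rule DERIV_imp_deriv) (auto intro!: derivative_eq_intros)
    have xx: "prol_xx (\<theta>, \<gamma>, \<phi>) t x u (p q 1) q 0 1 - prol_xx (\<theta>, \<gamma>, \<phi>) t x u (p q 0) q 0 0
        = \<phi>u - 2 * \<gamma>x - 3 * \<gamma>u * q" for q
      unfolding prol_xx_def prod.case Dx1_def dq
      unfolding prol_x Dx0_def \<gamma>x_def[symmetric] \<gamma>u_def[symmetric] by (simp add: algebra_simps)
    have tt: "prol_t T (\<theta>, \<gamma>, \<phi>) t x u (p q 1) q - prol_t T (\<theta>, \<gamma>, \<phi>) t x u (p q 0) q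
        = - 1/2 * (\<sigma> t x)\<^sup>2 * (\<phi>u - dt T (\<lambda>s. \<theta> s x u) t - \<gamma>u * q)" for q
      unfolding prol_t_def prod.case Dt0_def theta_derivs \<gamma>u_def[symmetric] \<phi>u_def[symmetric] p_def
      by (simp add: algebra_simps diff_divide_distrib add_divide_distrib)
    define c where "c = \<theta> t x u * \<sigma> t x * dt T (\<lambda>t'. \<sigma> t' x) t + \<gamma> t x u * \<sigma> t x * deriv (\<sigma> t) x
        + 1/2 * (\<sigma> t x)\<^sup>2 * (dt T (\<lambda>s. \<theta> s x u) t - 2 * \<gamma>x)"
    have "c - q * (\<sigma> t x)\<^sup>2 * \<gamma>u = 0" for q
    proof -
      have "PDE_lhs b \<sigma> g t x u (p q w) q 0 0 w = 0" for w
        by (simp add: PDE_lhs_eq[OF t'] p_def)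
      then have "pr2 T (\<theta>, \<gamma>, \<phi>) (PDE_lhs b \<sigma> g) t x u (p q 1) q 0 0 1
          - pr2 T (\<theta>, \<gamma>, \<phi>) (PDE_lhs b \<sigma> g) t x u (p q 0) q 0 0 0 = 0"
        using inv[OF t] by simp
      also have "pr2 T (\<theta>, \<gamma>, \<phi>) (PDE_lhs b \<sigma> g) t x u (p q 1) q 0 0 1
          - pr2 T (\<theta>, \<gamma>, \<phi>) (PDE_lhs b \<sigma> g) t x u (p q 0) q 0 0 0
        = \<theta> t x u * \<sigma> t x * dt T (\<lambda>t'. \<sigma> t' x) t + \<gamma> t x u * \<sigma> t x * deriv (\<sigma> t) x
          + (prol_t T (\<theta>, \<gamma>, \<phi>) t x u (p q 1) q - prol_t T (\<theta>, \<gamma>, \<phi>) t x u (p q 0) q)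
          + (prol_xx (\<theta>, \<gamma>, \<phi>) t x u (p q 1) q 0 1 - prol_xx (\<theta>, \<gamma>, \<phi>) t x u (p q 0) q 0 0)
            * (1/2 * (\<sigma> t x)\<^sup>2)"
        unfolding pr2_PDE_lhs[OF t'] prol_x by (simp add: algebra_simps)
      finally show ?thesis
        unfolding xx tt c_def
        by (simp add: algebra_simps diff_divide_distrib add_divide_distrib)
    qed
    from this[of 0] this[of 1] show ?thesis
      using sigma_nz[OF t'] by (simp add: \<gamma>u_def)
  qed
  have "deriv (\<lambda>u. \<gamma> t x u) u = 0" for u
    by (rule continuous_extension_zero[OF smooth_deriv_u[OF smooth] u0 t])
  with has_deriv_u[OF smooth t, of x] show ?thesis
    by (metis DERIV_zero_const)
qed

lemma FBSDE_eta_affine: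
  assumes smooth: "smooth3 T \<eta>"
    and drift: "\<And>z. drift_Y T b \<sigma> g \<tau> \<xi> \<eta> t x y z = 0"
    and t: "t \<in> {0..T}"
  shows "deriv (\<lambda>w. deriv (\<lambda>w'. \<eta> t x w') w) y = 0"
    and "deriv (\<lambda>w. deriv (\<lambda>v. \<eta> t v w) x) y = 0"
proof -
  define c where "c = drift_Y T b \<sigma> g \<tau> \<xi> \<eta> t x y 0"
  have g0: "g t x y = (\<lambda>k. g t x y 0)" "(\<lambda>v. g t v y z) = (\<lambda>v. g t v y 0)"
      "(\<lambda>w. g t x w z) = (\<lambda>w. g t x w 0)" "g t x y z = g t x y 0" for z
    using g_indep[OF t] by blast+
  have dg: "dt T (\<lambda>s. g s x y z * \<tau> s) t = dt T (\<lambda>s. g s x y 0 * \<tau> s) t" for z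
    using g_indep t by (intro dt_cong) auto
  have k: "deriv (\<lambda>k. g t x y k) z = 0" for z
    by (subst g0(1)) simp
  have "drift_Y T b \<sigma> g \<tau> \<xi> \<eta> t x y z = c
      + 1/2 * (deriv (\<lambda>w. deriv (\<lambda>w'. \<eta> t x w') w) y * z\<^sup>2
        + deriv (\<lambda>w. deriv (\<lambda>v. \<eta> t v w) x) y * \<sigma> t x * z)" for z
    unfolding c_def drift_Y_def k dg[of z] g0(2-4)[of z] by (simp add: algebra_simps add_divide_distrib)
  from this[of 1] this[of "-1"] this[of 0]
  show "deriv (\<lambda>w. deriv (\<lambda>w'. \<eta> t x w') w) y = 0" "deriv (\<lambda>w. deriv (\<lambda>v. \<eta> t v w) x) y = 0"
    using sigma_nz[OF t, of x] by (simp_all add: drift)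
qed

lemma L_FBSDE_subset: "L_FBSDE T b \<sigma> g H \<subseteq> L_PDE_hat T b \<sigma> g H"
proof (clarify)
  fix \<theta> \<gamma> \<eta> assume "(\<theta>, \<gamma>, \<eta>) \<in> L_FBSDE T b \<sigma> g H"
  then have smooth: "smooth3 T \<theta>" "smooth3 T \<gamma>" "smooth3 T \<eta>"
    and proj: "\<And>t x u. t \<in> {0..T} \<Longrightarrow> \<theta> t x u = \<theta> t 0 0" "\<And>t x u. t \<in> {0..T} \<Longrightarrow> \<gamma> t x u = \<gamma> t x 0"
    and eqs: "\<And>t x y z. t \<in> {0..T} \<Longrightarrow> drift_Y T b \<sigma> g (\<lambda>t. \<theta> t 0 0) (\<lambda>t x. \<gamma> t x 0) \<eta> t x y z = 0"
      "\<And>t x. t \<in> {0..T} \<Longrightarrow> drift_X T b \<sigma> (\<lambda>t. \<theta> t 0 0) (\<lambda>t x. \<gamma> t x 0) t x = 0"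
      "\<And>t x. t \<in> {0..T} \<Longrightarrow> diffusion_X T \<sigma> (\<lambda>t. \<theta> t 0 0) (\<lambda>t x. \<gamma> t x 0) t x = 0"
    and terminal: "\<forall>t\<in>{0..T}. \<forall>x. \<eta> t x (H x) = deriv H x * \<gamma> t x (H x)"
    unfolding L_FBSDE_iff by blast+
  have affine: "\<eta> t x u = (\<eta> t x 1 - \<eta> t x 0) * u + \<eta> t x 0"
    and flat: "((\<lambda>v. \<eta> t v 1 - \<eta> t v 0) has_real_derivative 0) (at x)"
    if t: "t \<in> {0..T}" for t x u
  proof -
    note e = FBSDE_eta_affine[OF smooth(3) eqs(1) t, OF t]
    have du: "deriv (\<eta> t x) u = deriv (\<eta> t x) 0" for u
      using has_deriv_u[OF smooth_deriv_u[OF smooth(3)] t, of x] unfolding e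
      by (rule DERIV_zero_const)
    have "(\<eta> t x has_real_derivative deriv (\<eta> t x) 0) (at u)" for u
      using has_deriv_u[OF smooth(3) t, of x u] unfolding du[of u] .
    then have "((\<lambda>u. \<eta> t x u - deriv (\<eta> t x) 0 * u) has_real_derivative 0) (at u)" for u
      by (auto intro!: derivative_eq_intros)
    then have "\<eta> t x u - deriv (\<eta> t x) 0 * u = \<eta> t x 0 - deriv (\<eta> t x) 0 * 0" for u
      by (rule DERIV_zero_const)
    from this[of u] this[of 1] show "\<eta> t x u = (\<eta> t x 1 - \<eta> t x 0) * u + \<eta> t x 0"
      by (simp add: algebra_simps)
    have "deriv (\<lambda>v. \<eta> t v 1) x = deriv (\<lambda>v. \<eta> t v 0) x"
      using has_deriv_u[OF smooth_deriv_x[OF smooth(3)] t, of x] unfolding e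
      by (rule DERIV_zero_const)
    then show "((\<lambda>v. \<eta> t v 1 - \<eta> t v 0) has_real_derivative 0) (at x)"
      using DERIV_diff[OF has_deriv_x[OF smooth(3) t, of 1 x] has_deriv_x[OF smooth(3) t, of 0 x]]
      by simp
  qed
  have const: "\<eta> t x 1 - \<eta> t x 0 = \<eta> t 0 1 - \<eta> t 0 0" if "t \<in> {0..T}" for t x
    using flat[OF that] by (rule DERIV_zero_const)
  interpret affine_vec_field T b \<sigma> g H \<theta> \<gamma> \<eta> "\<lambda>t. \<theta> t 0 0" "\<lambda>t. \<eta> t 0 1 - \<eta> t 0 0"
    "\<lambda>t x. \<gamma> t x 0" "\<lambda>t x. \<eta> t x 0"
  proof unfold_locales
    show "\<eta> t x u = (\<eta> t 0 1 - \<eta> t 0 0) * u + \<eta> t x 0" if "t \<in> {0..T}" for t x u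
      using affine[OF that] const[OF that] by metis
  qed (use smooth proj in blast)+
  have "pr2 T (\<theta>, \<gamma>, \<eta>) (PDE_lhs b \<sigma> g) t x u p q r s w = 0"
    if "t \<in> {0..<T}" "PDE_lhs b \<sigma> g t x u p q r s w = 0" for t x u p q r s w
    using that pr2_eq_determining[of t x u p q r s w] eqs by simp
  then have mem: "(\<theta>, \<gamma>, \<eta>) \<in> L_PDE T b \<sigma> g H"
    using smooth terminal by (auto simp: L_PDE_def smooth_vec_field_iff)
  show "(\<theta>, \<gamma>, \<eta>) \<in> L_PDE_hat T b \<sigma> g H"
    unfolding L_PDE_hat_def mem_Collect_eq prod.case
    by (intro conjI mem exI[of _ "\<lambda>t x. \<eta> t x 1 - \<eta> t x 0"] exI[of _ "\<lambda>t x. \<eta> t x 0"]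
        ballI allI affine flat)
qed

lemma L_PDE_hat_subset: "L_PDE_hat T b \<sigma> g H \<subseteq> L_FBSDE T b \<sigma> g H"
proof (clarify)
  fix \<theta> \<gamma> \<phi> assume "(\<theta>, \<gamma>, \<phi>) \<in> L_PDE_hat T b \<sigma> g H"
  then obtain \<delta> \<beta> where smooth: "smooth3 T \<theta>" "smooth3 T \<gamma>" "smooth3 T \<phi>"
    and inv: "\<And>t x u p q r s w. \<lbrakk>t \<in> {0..<T}; PDE_lhs b \<sigma> g t x u p q r s w = 0\<rbrakk> \<Longrightarrow>
        pr2 T (\<theta>, \<gamma>, \<phi>) (PDE_lhs b \<sigma> g) t x u p q r s w = 0"
    and terminal: "\<forall>t\<in>{0..T}. \<forall>x. \<phi> t x (H x) = deriv H x * \<gamma> t x (H x)"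
    and affine: "\<And>t x u. t \<in> {0..T} \<Longrightarrow> \<phi> t x u = \<delta> t x * u + \<beta> t x"
    and flat: "\<And>t x. t \<in> {0..T} \<Longrightarrow> ((\<lambda>v. \<delta> t v) has_real_derivative 0) (at x)"
    unfolding L_PDE_hat_def L_PDE_def smooth_vec_field_iff mem_Collect_eq prod.case by metis
  have theta: "\<theta> t x u = \<theta> t 0 0" if "t \<in> {0..T}" for t x u
    using theta_projectable[OF smooth(1) inv that] by blast
  have gamma: "\<gamma> t x u = \<gamma> t x 0" if "t \<in> {0..T}" for t x u
    using gamma_projectable[OF smooth(2) theta inv that] by blast
  have const: "\<delta> t x = \<delta> t 0" if "t \<in> {0..T}" for t x
    using flat[OF that] by (rule DERIV_zero_const)
  interpret affine_vec_field T b \<sigma> g H \<theta> \<gamma> \<phi> "\<lambda>t. \<theta> t 0 0" "\<lambda>t. \<phi> t 0 1 - \<phi> t 0 0"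
    "\<lambda>t x. \<gamma> t x 0" "\<lambda>t x. \<phi> t x 0"
  proof unfold_locales
    show "\<phi> t x u = (\<phi> t 0 1 - \<phi> t 0 0) * u + \<phi> t x 0" if "t \<in> {0..T}" for t x u
      using affine[OF that] const[OF that, of x] by simp
  qed (use smooth theta gamma in blast)+
  have sum0: "drift_Y T b \<sigma> g (\<lambda>t. \<theta> t 0 0) (\<lambda>t x. \<gamma> t x 0) \<phi> t x u 0
      - q * drift_X T b \<sigma> (\<lambda>t. \<theta> t 0 0) (\<lambda>t x. \<gamma> t x 0) t x
      + w * \<sigma> t x * diffusion_X T \<sigma> (\<lambda>t. \<theta> t 0 0) (\<lambda>t x. \<gamma> t x 0) t x = 0"
    if t: "t \<in> {0..<T}" for t x u q w
  proof -
    have t': "t \<in> {0..T}" using t by simp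
    define p where "p = - b t x * q - 1/2 * (\<sigma> t x)\<^sup>2 * w - g t x u 0"
    have "PDE_lhs b \<sigma> g t x u p q 0 0 w = 0"
      by (simp add: PDE_lhs_eq[OF t'] p_def)
    with inv[OF t this] pr2_eq_determining[OF t', of x u p q 0 0 w] show ?thesis
      by simp
  qed
  have Y: "drift_Y T b \<sigma> g (\<lambda>t. \<theta> t 0 0) (\<lambda>t x. \<gamma> t x 0) \<phi> t x u 0 = 0"
    if "t \<in> {0..<T}" for t x u
    using sum0[OF that, of x u 0 0] by simp
  have X: "drift_X T b \<sigma> (\<lambda>t. \<theta> t 0 0) (\<lambda>t x. \<gamma> t x 0) t x = 0" if "t \<in> {0..<T}" for t x
    using sum0[OF that, of x 0 1 0] Y[OF that] by simp
  have D: "diffusion_X T \<sigma> (\<lambda>t. \<theta> t 0 0) (\<lambda>t x. \<gamma> t x 0) t x = 0" if "t \<in> {0..<T}" for t x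
    using sum0[OF that, of x 0 0 1] Y[OF that] sigma_nz[of t x] that by simp
  note ends = continuous_zero_at_end[OF determining_continuous(1) T_pos Y]
    continuous_zero_at_end[OF determining_continuous(2) T_pos X]
    continuous_zero_at_end[OF determining_continuous(3) T_pos D]
  have "drift_Y T b \<sigma> g (\<lambda>t. \<theta> t 0 0) (\<lambda>t x. \<gamma> t x 0) \<phi> t x u z = 0" if "t \<in> {0..T}" for t x u z
    using ends(1)[OF _ that, of x u] drift_Y_eq[OF that, of x u z] drift_Y_eq[OF that, of x u 0] by simp
  then show "(\<theta>, \<gamma>, \<phi>) \<in> L_FBSDE T b \<sigma> g H"
    unfolding L_FBSDE_iff using smooth theta gamma terminal ends(2,3) by blast
qed

end

theorem theorem4p3:
  fixes T :: real
    and b \<sigma> :: "real \<Rightarrow> real \<Rightarrow> real"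
    and g :: "real \<Rightarrow> real \<Rightarrow> real \<Rightarrow> real \<Rightarrow> real"
    and H :: "real \<Rightarrow> real"
  assumes "T > 0"
    and "smooth_coefficients T b \<sigma> g H"
    and "\<And>t x. t \<in> {0..T} \<Longrightarrow> \<sigma> t x \<noteq> 0"
    and "\<And>t x y z z'. t \<in> {0..T} \<Longrightarrow> g t x y z = g t x y z'"
  shows "L_FBSDE T b \<sigma> g H = L_PDE_hat T b \<sigma> g H \<and> L_PDE_hat T b \<sigma> g H \<subseteq> L_PDE T b \<sigma> g H"
proof -
  interpret semilinear_problem T b \<sigma> g H
    using assms by unfold_locales
  show ?thesis
    using L_FBSDE_subset L_PDE_hat_subset unfolding L_PDE_hat_def by blast
qed

end
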